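(* For each integer $n\geq 3$, the BCK-algebra $\mathbf{M}_n$ is, up to isomorphism, the unique BCK-algebra of order $n$ with commuting degree $\frac{3n-2}{n^2}$. That is, $\operatorname{cd}(\mathbf{M}_n)=\frac{3n-2}{n^2}$, and every BCK-algebra $\mathbf{A}$ with $|\mathbf{A}|=n$ and $\operatorname{cd}(\mathbf{A})=\frac{3n-2}{n^2}$ is isomorphic to $\mathbf{M}_n$.
   Context: A BCK-algebra is an algebra $\mathbf{A}=\langle A;\cdot,0\rangle$ of type $(2,0)$ such that for all $x,y,z\in A$: (BCK1) $[(x\cdot y)\cdot(x\cdot z)]\cdot(z\cdot y)=0$; (BCK2) $[x\cdot(x\cdot y)]\cdot y=0$; (BCK3) $x\cdot x=0$; (BCK4) $0\cdot x=0$; (BCK5) $x\cdot y=0$ and $y\cdot x=0$ imply $x=y$. The order of $\mathbf{A}$ is $|\mathbf{A}|=|A|$. Define $x\wedge y:=y\cdot(y\cdot x)$. Elements $x,y$ commute if $x\wedge y=y\wedge x$. For a finite BCK-algebra $\mathbf{A}$, let $C(\mathbf{A})=\{(x,y)\in A^2 : x\wedge y=y\wedge x\}$; the commuting degree of $\mathbf{A}$ is $\operatorname{cd}(\mathbf{A})=\frac{|C(\mathbf{A})|}{|\mathbf{A}|^2}$. Iséki's extension: given a BCK-algebra $\mathbf{A}$, the BCK-algebra $\mathbf{A}\oplus\top$ has underlying set $A\cup\{\top\}$, where $\top\notin A$ is a new element, with the operation of $\mathbf{A}$ extended by $x\cdot\top=0$, $\top\cdot\top=0$, and $\top\cdot x=\top$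 for all $x\in A$. Let $\mathbf{3}^{\text{p}}$ be the BCK-algebra on $\{0,1,2\}$ with $0\cdot x=0$ for all $x$; $1\cdot 0=1$, $1\cdot 1=0$, $1\cdot 2=0$; $2\cdot 0=2$, $2\cdot 1=2$, $2\cdot 2=0$. The algebras $\mathbf{M}_n$ are defined recursively by $\mathbf{M}_3=\mathbf{3}^{\text{p}}$ and $\mathbf{M}_n=\mathbf{M}_{n-1}\oplus\top$ for $n>3$. *)

theory Defs
  imports Complex_Main
begin

record 'a bck =
  carr :: "'a set"
  mul :: "'a \<Rightarrow> 'a \<Rightarrow> 'a"
  zero :: "'a"

text \<open>Only the values of \<open>mul\<close> on the carrier are relevant; elsewhere it is arbitrary.\<close>

locale bck_algebra =
  fixes A :: "'a bck"
  assumes zero_closed: "zero A \<in> carr A"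
    and mul_closed: "\<lbrakk>x \<in> carr A; y \<in> carr A\<rbrakk> \<Longrightarrow> mul A x y \<in> carr A"
    and bck1: "\<lbrakk>x \<in> carr A; y \<in> carr A; z \<in> carr A\<rbrakk>
      \<Longrightarrow> mul A (mul A (mul A x y) (mul A x z)) (mul A z y) = zero A"
    and bck2: "\<lbrakk>x \<in> carr A; y \<in> carr A\<rbrakk> \<Longrightarrow> mul A (mul A x (mul A x y)) y = zero A"
    and bck3: "x \<in> carr A \<Longrightarrow> mul A x x = zero A"
    and bck4: "x \<in> carr A \<Longrightarrow> mul A (zero A) x = zero A"
    and bck5: "\<lbrakk>x \<in> carr A; y \<in> carr A; mul A x y = zero A; mul A y x = zero A\<rbrakk> \<Longrightarrow> x = y"

definition bck_order :: "'a bck \<Rightarrow> nat" where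
  "bck_order A = card (carr A)"

definition bck_meet :: "'a bck \<Rightarrow> 'a \<Rightarrow> 'a \<Rightarrow> 'a" where
  "bck_meet A x y = mul A y (mul A y x)"

definition commuting_pairs :: "'a bck \<Rightarrow> ('a \<times> 'a) set" where
  "commuting_pairs A =
    {(x, y). x \<in> carr A \<and> y \<in> carr A \<and> bck_meet A x y = bck_meet A y x}"

text \<open>Meaningful for finite algebras only.\<close>

definition cd :: "'a bck \<Rightarrow> real" where
  "cd A = real (card (commuting_pairs A)) / (real (bck_order A))\<^sup>2"

definition bck_iso :: "('a \<Rightarrow> 'b) \<Rightarrow> 'a bck \<Rightarrow> 'b bck \<Rightarrow> bool" where
  "bck_iso h A B \<longleftrightarrow> bij_betw h (carr A) (carr B) \<and> h (zero A) = zero B \<and>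
    (\<forall>x\<in>carr A. \<forall>y\<in>carr A. h (mul A x y) = mul B (h x) (h y))"

definition bck_isomorphic :: "'a bck \<Rightarrow> 'b bck \<Rightarrow> bool" where
  "bck_isomorphic A B \<longleftrightarrow> (\<exists>h. bck_iso h A B)"

text \<open>Iseki's extension of \<open>A\<close> by the element \<open>t\<close>, which must not lie in \<open>carr A\<close>.\<close>

definition iseki_ext :: "'a bck \<Rightarrow> 'a \<Rightarrow> 'a bck" where
  "iseki_ext A t = \<lparr>carr = insert t (carr A),
     mul = (\<lambda>x y. if y = t then zero A else if x = t then t else mul A x y),
     zero = zero A\<rparr>"

definition three_p :: "nat bck" where
  "three_p = \<lparr>carr = {0, 1, 2},
     mul = (\<lambda>x y. if (x, y) = (1, 0) then 1
                  else if (x, y) = (2, 0) \<or> (x, y) = (2, 1) then 2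
                  else 0),
     zero = 0\<rparr>"

text \<open>
  \<open>M n\<close> is realised on \<open>{0..<n}\<close>, so \<open>n - 1\<close> is a legitimate new element for the extension of
  \<open>M (n - 1)\<close>. Values at \<open>n < 3\<close> are irrelevant.
\<close>

fun M :: "nat \<Rightarrow> nat bck" where
  "M n = (if n \<le> 3 then three_p else iseki_ext (M (n - 1)) (n - 1))"

declare M.simps [simp del]

lemma carr_M: "n \<ge> 3 \<Longrightarrow> carr (M n) = {0..<n}"
proof (induction n rule: dec_induct)
  case base
  show ?case by (auto simp: M.simps three_p_def)
next
  case (step n)
  then show ?case by (auto simp: M.simps[of "Suc n"] iseki_ext_def)
qed

lemma M_new_element: "n > 3 \<Longrightarrow> n - 1 \<notin> carr (M (n - 1))"
  by (simp add: carr_M)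

end

theory Submission
  imports Defs
begin

text \<open>
  The pairs with equal entries or with an entry \<open>0\<close> always commute, and there are \<open>3n - 2\<close> of them;
  so the commuting degree is \<open>(3n - 2) / n\<^sup>2\<close> iff no other pair commutes. Suppose this holds and
  \<open>0 < x < y\<close>. The element \<open>x \<and> y = y \<cdot> (y \<cdot> x)\<close> commutes with \<open>y\<close>, hence is \<open>0\<close> or \<open>y\<close>; it lies
  below \<open>x\<close>, so it is \<open>0\<close> and \<open>y \<cdot> x = y\<close>. If \<open>x, y\<close> were incomparable, then \<open>x \<cdot> y < x\<close> would
  give \<open>x \<cdot> (x \<cdot> y) = x\<close> and so \<open>x \<le> y\<close>; thus \<open>x \<cdot> y = x\<close>, likewise \<open>y \<cdot> x = y\<close>, and \<open>x, y\<close> would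
  commute. So the algebra is a chain with \<open>y \<cdot> x = y\<close> whenever \<open>x < y\<close>, which determines it up to
  isomorphism.
\<close>

definition trivial_pairs :: "'a bck \<Rightarrow> ('a \<times> 'a) set" where
  "trivial_pairs A = {(x, y). x \<in> carr A \<and> y \<in> carr A \<and> (x = y \<or> x = zero A \<or> y = zero A)}"

context bck_algebra
begin

lemma mul_zero_right: "x \<in> carr A \<Longrightarrow> mul A x (zero A) = x"
  by (metis bck2 bck3 bck4 bck5 mul_closed zero_closed)

lemma mul_le_left: "x \<in> carr A \<Longrightarrow> y \<in> carr A \<Longrightarrow> mul A (mul A x y) x = zero A"
  by (metis bck1 bck4 mul_closed mul_zero_right zero_closed)

lemma le_trans:
  assumes "x \<in> carr A" "y \<in> carr A" "z \<in> carr A" "mul A x y = zero A" "mul A y z = zero A"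
  shows "mul A x z = zero A"
  by (metis assms bck1 mul_closed mul_zero_right)

text \<open>By BCK1, left multiplication by \<open>y\<close> reverses the order; applied to
  \<open>mul A y (mul A y x)\<close>, which lies below \<open>x\<close>, it gives one inequality.
  BCK2 gives the other.\<close>

lemma mul_mul_mul:
  assumes "x \<in> carr A" "y \<in> carr A"
  shows "mul A y (mul A y (mul A y x)) = mul A y x"
proof (rule bck5)
  show "mul A (mul A y (mul A y (mul A y x))) (mul A y x) = zero A"
    using assms by (simp add: bck2 mul_closed)
  have "mul A (mul A (mul A y x) (mul A y (mul A y (mul A y x))))
      (mul A (mul A y (mul A y x)) x) = zero A"
    using assms by (simp add: bck1 mul_closed)
  then show "mul A (mul A y x) (mul A y (mul A y (mul A y x))) = zero A"
    using assms by (simp add: bck2 mul_closed mul_zero_right)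
qed (use assms in \<open>simp_all add: mul_closed\<close>)

lemma trivial_pairs_subset: "trivial_pairs A \<subseteq> commuting_pairs A"
  by (auto simp: trivial_pairs_def commuting_pairs_def bck_meet_def mul_zero_right bck3 bck4
      zero_closed)

lemma card_trivial_pairs:
  assumes "finite (carr A)"
  shows "card (trivial_pairs A) = 3 * card (carr A) - 2"
proof -
  let ?S = "carr A - {zero A}"
  let ?l = "\<lambda>x. (zero A, x)" and ?r = "\<lambda>x. (x, zero A)" and ?d = "\<lambda>x. (x, x)"
  \<comment> \<open>Row of zero, column of zero and diagonal; dropping zero from the last two makes
    the pieces disjoint, of sizes \<open>n\<close>, \<open>n - 1\<close>,
    \<open>n - 1\<close>.\<close>
  have "trivial_pairs A = ?l ` carr A \<union> (?r ` ?S \<union> ?d ` ?S)"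
    by (auto simp: trivial_pairs_def zero_closed)
  also have "card \<dots> = card (?l ` carr A) + card (?r ` ?S \<union> ?d ` ?S)"
    by (rule card_Un_disjoint) (use assms in auto)
  also have "card (?r ` ?S \<union> ?d ` ?S) = card (?r ` ?S) + card (?d ` ?S)"
    by (rule card_Un_disjoint) (use assms in auto)
  also have "card (?l ` carr A) + (card (?r ` ?S) + card (?d ` ?S)) =
      card (carr A) + (card ?S + card ?S)"
    by (simp add: card_image inj_on_def)
  also have "card ?S = card (carr A) - 1"
    using assms zero_closed by simp
  finally show ?thesis
    using assms zero_closed card_gt_0_iff[of "carr A"] by auto
qed

text \<open>The trivial pairs always commute, so for a finite carrier equal cardinalities force
  equal sets.\<close>

lemma cd_eq_iff:
  assumes "finite (carr A)"
  shows "cd A = (3 * real (bck_order A) - 2) / (real (bck_order A))\<^sup>2 \<longleftrightarrow>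
    commuting_pairs A = trivial_pairs A"
proof -
  have pos: "card (carr A) \<ge> 1"
    using assms zero_closed card_gt_0_iff[of "carr A"] by fastforce
  have fin: "finite (commuting_pairs A)"
    by (rule finite_subset[of _ "carr A \<times> carr A"]) (use assms in \<open>auto simp: commuting_pairs_def\<close>)
  have "cd A = (3 * real (bck_order A) - 2) / (real (bck_order A))\<^sup>2 \<longleftrightarrow>
      real (card (commuting_pairs A)) = 3 * real (card (carr A)) - 2"
    using pos by (simp add: cd_def bck_order_def)
  also have "\<dots> \<longleftrightarrow> card (commuting_pairs A) = card (trivial_pairs A)"
    using pos by (simp add: card_trivial_pairs[OF assms] of_nat_diff) linarith
  also have "\<dots> \<longleftrightarrow> commuting_pairs A = trivial_pairs A"
    using card_subset_eq[OF fin trivial_pairs_subset] by metis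
  finally show ?thesis .
qed

lemma mul_eq_left_if_less:
  assumes triv: "commuting_pairs A = trivial_pairs A"
    and mem: "x \<in> carr A" "y \<in> carr A" and "mul A x y = zero A" "x \<noteq> y"
  shows "mul A y x = y"
proof -
  define z where "z = mul A y (mul A y x)"
  have z: "z \<in> carr A" "mul A z x = zero A"
    using mem by (simp_all add: z_def mul_closed bck2)
  have zy: "mul A z y = zero A"
    using le_trans[of z x y] z mem assms by blast
  \<comment> \<open>Both meets are \<open>z\<close>: the right one because \<open>z\<close> lies
    below \<open>y\<close>, the left one by \<open>mul_mul_mul\<close>.\<close>
  have "bck_meet A z y = bck_meet A y z"
    using mem z zy by (simp add: bck_meet_def mul_zero_right)
      (simp add: z_def mul_mul_mul mul_closed)
  then have "(z, y) \<in> trivial_pairs A"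
    using triv z mem by (auto simp: commuting_pairs_def)
  \<comment> \<open>Otherwise \<open>y\<close> would lie below \<open>x\<close>, and antisymmetry
    would give \<open>x = y\<close>.\<close>
  moreover have "z \<noteq> y"
    using z mem assms bck5 by blast
  ultimately have "z = zero A"
    using assms bck4 z mem by (auto simp: trivial_pairs_def mul_zero_right)
  then show ?thesis
    using mem mul_le_left bck5 mul_closed z_def by metis
qed

lemma total_if_trivial:
  assumes triv: "commuting_pairs A = trivial_pairs A"
    and mem: "x \<in> carr A" "y \<in> carr A"
  shows "mul A x y = zero A \<or> mul A y x = zero A"
proof (rule ccontr)
  assume *: "\<not> ?thesis"
  have eq: "mul A u v = u"
    if "u \<in> carr A" "v \<in> carr A" "mul A u v \<noteq> zero A" for u v
  proof (rule ccontr)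
    assume "mul A u v \<noteq> u"
    then have "mul A u (mul A u v) = u"
      using mul_eq_left_if_less[OF triv, of "mul A u v" u] that
      by (simp add: mul_closed mul_le_left)
    then show False
      using bck2[of u v] that by simp
  qed
  \<comment> \<open>Both meets vanish, since \<open>eq\<close> turns them into
    \<open>mul A y y\<close> and \<open>mul A x x\<close>.\<close>
  have "bck_meet A x y = bck_meet A y x"
    using eq[of x y] eq[of y x] * mem by (simp add: bck_meet_def bck3)
  then have "(x, y) \<in> trivial_pairs A"
    using triv mem by (auto simp: commuting_pairs_def)
  then show False
    using * mem by (auto simp: trivial_pairs_def bck3 bck4)
qed

end

lemma zero_M: "zero (M n) = 0"
proof (induction n)
  case (Suc n)
  then show ?case by (simp add: M.simps[of "Suc n"] iseki_ext_def three_p_def)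
qed (simp add: M.simps three_p_def)

text \<open>Each extension puts a new greatest element on top, and \<open>three_p\<close> already
  has this form on the chain 0 < 1 < 2.\<close>

lemma mul_M:
  assumes "n \<ge> 3" "x < n" "y < n"
  shows "mul (M n) x y = (if x \<le> y then 0 else x)"
  using assms
proof (induction n arbitrary: x y rule: dec_induct)
  case base
  then have "x \<in> {0, 1, 2}" "y \<in> {0, 1, 2}" by auto
  then show ?case by (auto simp: M.simps three_p_def)
next
  case (step n)
  then show ?case
    by (auto simp: M.simps[of "Suc n"] iseki_ext_def zero_M)
qed

lemma bck_algebra_M:
  assumes "n \<ge> 3"
  shows "bck_algebra (M n)"
  by unfold_locales (use assms in \<open>auto simp: carr_M zero_M mul_M split: if_splits\<close>)

text \<open>For 0 < x < y, \<open>mul_M\<close> makes one meet \<open>mul (M n) y y = 0\<close> and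
  the other \<open>mul (M n) x 0 = x\<close>, so they differ.\<close>

lemma commuting_pairs_M:
  assumes "n \<ge> 3"
  shows "commuting_pairs (M n) = trivial_pairs (M n)"
  using assms
  by (auto simp: commuting_pairs_def trivial_pairs_def bck_meet_def carr_M zero_M mul_M
      split: if_splits)

lemma (in bck_algebra) isomorphic_M:
  assumes n: "card (carr A) = n" "n \<ge> 3" and triv: "commuting_pairs A = trivial_pairs A"
  shows "bck_isomorphic A (M n)"
proof -
  \<comment> \<open>The rank of \<open>x\<close>: the number of elements strictly below it.\<close>
  define h where "h x = card {y \<in> carr A. mul A y x = zero A \<and> y \<noteq> x}" for x
  have fin: "finite (carr A)"
    using n by (auto intro: card_ge_0_finite)
  have h_less: "h x < h y"
    if "x \<in> carr A" "y \<in> carr A" "mul A x y = zero A" "x \<noteq> y" for x y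
    unfolding h_def
  proof (rule psubset_card_mono)
    show "finite {z \<in> carr A. mul A z y = zero A \<and> z \<noteq> y}"
      using fin by simp
    have "{z \<in> carr A. mul A z x = zero A \<and> z \<noteq> x} \<subseteq> {z \<in> carr A. mul A z y = zero A \<and> z \<noteq> y}"
      using that le_trans bck5 by blast
    \<comment> \<open>The inclusion is strict because \<open>x\<close> belongs only to the larger
      set.\<close>
    then show "{z \<in> carr A. mul A z x = zero A \<and> z \<noteq> x} \<subset> {z \<in> carr A. mul A z y = zero A \<and> z \<noteq> y}"
      using that by blast
  qed
  have h_bound: "h x < n" if "x \<in> carr A" for x
    unfolding h_def n(1)[symmetric] using that fin by (intro psubset_card_mono) auto
  have h_inj: "inj_on h (carr A)"
    using total_if_trivial[OF triv] h_less by (metis inj_onI less_irrefl)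
  have "h ` carr A = {0..<n}"
    using h_bound card_image[OF h_inj] n by (intro card_subset_eq) auto
  then have bij: "bij_betw h (carr A) (carr (M n))"
    using h_inj n by (simp add: bij_betw_def carr_M)
  have h0: "h (zero A) = 0"
    unfolding h_def using mul_zero_right by (auto simp: card_eq_0_iff)
  have "h (mul A x y) = mul (M n) (h x) (h y)" if xy: "x \<in> carr A" "y \<in> carr A" for x y
  proof (cases "mul A x y = zero A")
    case True
    then have "h x \<le> h y"
      using h_less[of x y] xy by (cases "x = y") auto
    then show ?thesis
      using True xy h_bound n by (simp add: mul_M h0)
  next
    case False
    \<comment> \<open>Here \<open>y\<close> is strictly below \<open>x\<close>, so both products
      return their left factor.\<close>
    then have le: "mul A y x = zero A" and ne: "y \<noteq> x"
      using total_if_trivial[OF triv xy] xy bck3 by auto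
    then show ?thesis
      using mul_eq_left_if_less[OF triv, of y x] h_less[of y x] xy h_bound n by (simp add: mul_M)
  qed
  then show ?thesis
    using bij h0 by (auto simp: bck_isomorphic_def bck_iso_def zero_M)
qed

theorem theorem3p5:
  fixes n :: nat
  assumes "n \<ge> 3"
  shows "bck_algebra (M n) \<and> bck_order (M n) = n \<and>
    cd (M n) = (3 * real n - 2) / (real n)\<^sup>2 \<and>
    (\<forall>A :: 'a bck. bck_algebra A \<and> bck_order A = n \<and>
        cd A = (3 * real n - 2) / (real n)\<^sup>2 \<longrightarrow> bck_isomorphic A (M n))"
proof (intro conjI allI impI)
  show alg: "bck_algebra (M n)"
    using assms by (rule bck_algebra_M)
  show ord: "bck_order (M n) = n"
    using assms by (simp add: bck_order_def carr_M)
  show "cd (M n) = (3 * real n - 2) / (real n)\<^sup>2"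
    using bck_algebra.cd_eq_iff[OF alg] commuting_pairs_M[OF assms] assms
    by (simp add: ord carr_M)
next
  fix A :: "'a bck"
  assume *: "bck_algebra A \<and> bck_order A = n \<and> cd A = (3 * real n - 2) / (real n)\<^sup>2"
  then interpret bck_algebra A by simp
  \<comment> \<open>An infinite carrier would have \<open>card\<close> equal to 0.\<close>
  have "finite (carr A)"
    using * assms by (auto simp: bck_order_def intro: card_ge_0_finite)
  then show "bck_isomorphic A (M n)"
    using isomorphic_M[of n] cd_eq_iff * assms by (auto simp: bck_order_def)
qed

end
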